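(* Let $X$ be the Ornstein-Uhlenbeck process on $\mathbb{R}$ with generator $\partial^2-x\partial$ started from $X_0=0$, let $m_t$ be the law of $X_t$, and let $\gamma$ be the standard centered Gaussian distribution on $\mathbb{R}$. There exists a constant $C>0$ such that for all $t\ge0$ and all $M>0$, $$\|m_t-\gamma\|_{\mathrm{tv}}\le C(1\vee M)^2\exp(-2t)+\frac{\sqrt{2}}{\sqrt{\pi}\,M}\exp(-M^2/2).$$
   Context: The process $X$ solves $dX_t=-X_t\,dt+\sqrt2\,dB_t$ with $B$ a standard Brownian motion. The total variation norm is normalized by $\|\nu-\gamma\|_{\mathrm{tv}}=\frac12\sup_{|f|\le 1}(\nu[f]-\gamma[f])$, the supremum being over measurable functions $f$ with values in $[-1,1]$. $1\vee M=\max(1,M)$. *)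

theory Defs
  imports "HOL-Probability.Probability"
begin

definition standard_brownian_motion :: "'a measure \<Rightarrow> (real \<Rightarrow> 'a \<Rightarrow> real) \<Rightarrow> bool" where
  "standard_brownian_motion P B \<longleftrightarrow>
     prob_space P \<and>
     (\<forall>t\<ge>0. B t \<in> borel_measurable P) \<and>
     (AE \<omega> in P. B 0 \<omega> = 0) \<and>
     (AE \<omega> in P. continuous_on {0..} (\<lambda>t. B t \<omega>)) \<and>
     (\<forall>s t. 0 \<le> s \<and> s < t \<longrightarrow>
        distributed P lborel (\<lambda>\<omega>. B t \<omega> - B s \<omega>) (normal_density 0 (sqrt (t - s)))) \<and>
     (\<forall>(n::nat) (\<tau>::nat \<Rightarrow> real). 0 \<le> \<tau> 0 \<and> mono \<tau> \<longrightarrow>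
        prob_space.indep_vars P (\<lambda>_. borel) (\<lambda>i \<omega>. B (\<tau> (Suc i)) \<omega> - B (\<tau> i) \<omega>) {..<n})"

text \<open>
  \<open>X\<close> solves \<open>dX = - X dt + sqrt 2 dB\<close>, \<open>X 0 = x0\<close>. The noise being additive, the stochastic
  integral of the constant \<open>sqrt 2\<close> is \<open>sqrt 2 (B t - B 0)\<close> with \<open>B 0 = 0\<close>, so that the integral
  form of the equation makes sense path by path. Adaptedness of \<open>X\<close> need not be required: almost
  surely, a path of \<open>X\<close> up to time \<open>t\<close> is determined by the path of \<open>B\<close> up to time \<open>t\<close>.
\<close>

definition ornstein_uhlenbeck ::
  "'a measure \<Rightarrow> (real \<Rightarrow> 'a \<Rightarrow> real) \<Rightarrow> real \<Rightarrow> (real \<Rightarrow> 'a \<Rightarrow> real) \<Rightarrow> bool" where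
  "ornstein_uhlenbeck P B x0 X \<longleftrightarrow>
     standard_brownian_motion P B \<and>
     (\<forall>t\<ge>0. X t \<in> borel_measurable P) \<and>
     (AE \<omega> in P. X 0 \<omega> = x0) \<and>
     (AE \<omega> in P. continuous_on {0..} (\<lambda>t. X t \<omega>)) \<and>
     (AE \<omega> in P. \<forall>t\<ge>0.
        X t \<omega> = X 0 \<omega> + integral {0..t} (\<lambda>s. - X s \<omega>) + sqrt 2 * B t \<omega>)"

definition std_gaussian :: "real measure" where
  "std_gaussian = density lborel (\<lambda>x. ennreal (std_normal_density x))"

text \<open>
  Only meaningful for finite Borel measures, for which the supremum is over a bounded set.
\<close>

definition tv_dist :: "real measure \<Rightarrow> real measure \<Rightarrow> real" where
  "tv_dist \<nu> \<mu> =
     1 / 2 * (SUP f\<in>{f \<in> borel_measurable borel. \<forall>x. \<bar>f x\<bar> \<le> 1}.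
                integral\<^sup>L \<nu> f - integral\<^sup>L \<mu> f)"

end

(*
  Path by path, exp t * X t is the limit of the weighted increments
  sqrt 2 * (\<Sum>i<n. exp (t_i) * (B (t_(i+1)) - B (t_i))), which are centred Gaussian; convergence of
  characteristic functions and Levy's uniqueness theorem give X t ~ N(0, s^2) with
  s^2 = 1 - exp (- 2 t). Since s \<le> 1, the density of N(0, s^2) is at most 1/s times the
  standard one, so the total variation distance is at most 1/s - 1, which is of order exp (- 2 t).
  Hence C = 2 works without the M-dependent terms.
*)
theory Submission
  imports Defs "HOL-Real_Asymp.Real_Asymp"
begin

section \<open>Discretisation of the equation along a single path\<close>

text \<open>Subtracting the equation at \<open>a\<close> from that at \<open>b\<close> gives
  \<open>c * (\<beta> b - \<beta> a)\<close> as \<open>x b - x a\<close> plus the integral of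
  \<open>x\<close>. What is left is \<open>(exp b - exp a) * x b\<close> minus \<open>exp a\<close>
  times that integral, and the first factor is itself the integral of \<open>exp\<close>. On a short
  interval the integrand compares values of \<open>exp r * x s\<close> at two nearby points
  \<open>(r, s)\<close>.\<close>

lemma exp_weighted_increment:
  fixes x \<beta> :: "real \<Rightarrow> real"
  assumes "0 \<le> a" "a \<le> b" and cont: "continuous_on {0..b} x"
    and eq: "\<And>s. s \<in> {a, b} \<Longrightarrow> x s = x0 + integral {0..s} (\<lambda>s. - x s) + c * \<beta> s"
  shows "exp b * x b - exp a * x a - exp a * (c * (\<beta> b - \<beta> a))
           = integral {a..b} (\<lambda>s. exp s * x b - exp a * x s)"
proof -
  have int: "x integrable_on {0..b}"
    using cont by (rule integrable_continuous_real)
  have intab: "x integrable_on {a..b}"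
    by (rule integrable_subinterval_real[OF int]) (use assms in auto)
  have "integral {0..a} x + integral {a..b} x = integral {0..b} x"
    using assms int by (intro Henstock_Kurzweil_Integration.integral_combine) auto
  then have noise: "c * (\<beta> b - \<beta> a) = x b - x a + integral {a..b} x"
    using eq[of a] eq[of b] by (simp add: algebra_simps)
  have "(exp has_integral (exp b - exp a)) {a..b}"
    using assms by (intro fundamental_theorem_of_calculus)
      (auto intro!: derivative_eq_intros simp: has_real_derivative_iff_has_vector_derivative[symmetric])
  then have "((\<lambda>s. exp s * x b - exp a * x s) has_integral
      ((exp b - exp a) * x b - exp a * integral {a..b} x)) {a..b}"
    using intab by (intro has_integral_diff has_integral_mult_left has_integral_mult_right
        integrable_integral)
  then show ?thesis
    unfolding noise by (simp add: integral_unique algebra_simps)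
qed

text \<open>A pathwise form of d(exp s * x) = exp s * c d\<beta>, the integral being a limit of
  left-endpoint sums. The increments of \<open>exp s * x s\<close> telescope, and each differs from
  its noise term by an error that is small relative to the mesh.\<close>

lemma additive_noise_path_limit:
  fixes x \<beta> :: "real \<Rightarrow> real" and t :: real
  assumes "0 < t" and cont: "continuous_on {0..t} x"
    and eq: "\<And>s. s \<in> {0..t} \<Longrightarrow> x s = x0 + integral {0..s} (\<lambda>s. - x s) + c * \<beta> s"
  shows "(\<lambda>n. \<Sum>i<n. exp (t * i / n) * (c * (\<beta> (t * Suc i / n) - \<beta> (t * i / n))))
           \<longlonglongrightarrow> exp t * x t - x 0"
proof (rule LIMSEQ_I)
  fix r :: real assume "0 < r"
  \<comment> \<open>Each of the \<open>n\<close> cells contributes an error of at most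
    \<open>\<epsilon> * (t / n)\<close>, so the total is at most
    \<open>\<epsilon> * t = r / 2\<close>.\<close>
  define \<epsilon> where "\<epsilon> = r / (2 * t)"
  have "\<epsilon> > 0" using \<open>0 < r\<close> \<open>0 < t\<close> by (simp add: \<epsilon>_def)
  have "continuous_on ({0..t} \<times> {0..t}) (\<lambda>p. exp (fst p) * x (snd p))"
    by (intro continuous_intros continuous_on_compose2[OF cont]) auto
  then have "uniformly_continuous_on ({0..t} \<times> {0..t}) (\<lambda>p. exp (fst p) * x (snd p))"
    by (intro compact_uniformly_continuous compact_Times) auto
  then obtain \<delta> where "\<delta> > 0" and \<delta>:
    "\<And>p q. p \<in> {0..t} \<times> {0..t} \<Longrightarrow> q \<in> {0..t} \<times> {0..t} \<Longrightarrow> dist p q < \<delta> \<Longrightarrow>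
       dist (exp (fst p) * x (snd p)) (exp (fst q) * x (snd q)) < \<epsilon>"
    using \<open>\<epsilon> > 0\<close> unfolding uniformly_continuous_on_def by metis
  \<comment> \<open>The points compared below differ by at most the mesh \<open>t / n\<close> in
    each coordinate, hence by at most \<open>2 * t / n\<close>.\<close>
  obtain N :: nat where N: "N > 2 * t / \<delta>" using reals_Archimedean2 by blast
  show "\<exists>no. \<forall>n\<ge>no. norm ((\<Sum>i<n. exp (t * i / n) * (c * (\<beta> (t * Suc i / n) - \<beta> (t * i / n))))
      - (exp t * x t - x 0)) < r"
  proof (intro exI[of _ N] allI impI)
    fix n :: nat assume "N \<le> n"
    then have "real n > 2 * t / \<delta>" using N by linarith
    moreover have "2 * t / \<delta> > 0" using \<open>0 < t\<close> \<open>\<delta> > 0\<close> by simp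
    ultimately have n: "real n > 0" "2 * t / n < \<delta>"
      using \<open>\<delta> > 0\<close> by (linarith, metis divide_less_eq mult.commute order.strict_trans)
    define \<tau> where "\<tau> i = t * real i / real n" for i
    have \<tau>: "0 \<le> \<tau> i" "\<tau> i \<le> \<tau> (Suc i)" "\<tau> (Suc i) - \<tau> i = t / n" for i
      using n \<open>0 < t\<close> by (auto simp: \<tau>_def field_simps)
    have \<tau>_le: "\<tau> (Suc i) \<le> t" if "i < n" for i
    proof -
      have "real (Suc i) \<le> real n" using that by simp
      then have "t * real (Suc i) \<le> t * real n"
        using \<open>0 < t\<close> by (intro mult_left_mono) auto
      then show ?thesis using n by (simp add: \<tau>_def field_simps)
    qed
    (* The remainder is an integral of the oscillation of exp r * x s on a small square, which
       uniform continuity controls; no explicit solution of the equation is needed. *)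
    let ?R = "\<lambda>i. integral {\<tau> i..\<tau> (Suc i)} (\<lambda>s. exp s * x (\<tau> (Suc i)) - exp (\<tau> i) * x s)"
    have "exp t * x t - x 0 = (\<Sum>i<n. exp (\<tau> (Suc i)) * x (\<tau> (Suc i)) - exp (\<tau> i) * x (\<tau> i))"
      using n by (subst sum_lessThan_telescope) (simp add: \<tau>_def)
    then have "(exp t * x t - x 0) - (\<Sum>i<n. exp (\<tau> i) * (c * (\<beta> (\<tau> (Suc i)) - \<beta> (\<tau> i))))
        = (\<Sum>i<n. exp (\<tau> (Suc i)) * x (\<tau> (Suc i)) - exp (\<tau> i) * x (\<tau> i)
             - exp (\<tau> i) * (c * (\<beta> (\<tau> (Suc i)) - \<beta> (\<tau> i))))"
      by (simp add: sum_subtractf)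
    also have "\<dots> = (\<Sum>i<n. ?R i)"
    proof (rule sum.cong[OF refl])
      fix i assume "i \<in> {..<n}"
      then have "\<tau> (Suc i) \<le> t" using \<tau>_le by auto
      moreover have "0 \<le> \<tau> i" "\<tau> i \<le> \<tau> (Suc i)" using \<tau> by auto
      ultimately show "exp (\<tau> (Suc i)) * x (\<tau> (Suc i)) - exp (\<tau> i) * x (\<tau> i)
          - exp (\<tau> i) * (c * (\<beta> (\<tau> (Suc i)) - \<beta> (\<tau> i))) = ?R i"
        by (intro exp_weighted_increment[of _ _ x x0] eq continuous_on_subset[OF cont]) auto
    qed
    also have "norm \<dots> \<le> (\<Sum>i<n. \<epsilon> * (t / n))"
    proof (rule sum_norm_le)
      fix i assume "i \<in> {..<n}"
      then have le: "\<tau> (Suc i) \<le> t" using \<tau>_le by auto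
      have "norm (?R i) \<le> \<epsilon> * (\<tau> (Suc i) - \<tau> i)"
      proof (rule integral_bound)
        show "\<tau> i \<le> \<tau> (Suc i)" by (rule \<tau>)
        show "continuous_on {\<tau> i..\<tau> (Suc i)} (\<lambda>s. exp s * x (\<tau> (Suc i)) - exp (\<tau> i) * x s)"
          using le \<tau>(1)[of i] by (intro continuous_intros continuous_on_subset[OF cont]) auto
        fix s assume s: "s \<in> {\<tau> i..\<tau> (Suc i)}"
        have "dist (s, \<tau> (Suc i)) (\<tau> i, s) \<le> dist s (\<tau> i) + dist (\<tau> (Suc i)) s"
          unfolding dist_prod_def by (simp add: sqrt_sum_squares_le_sum)
        also have "\<dots> \<le> 2 * t / n"
          using s \<tau>(3)[of i] \<tau>(2)[of i] \<open>0 < t\<close> n by (simp add: dist_real_def field_simps)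
        also have "\<dots> < \<delta>" by (rule n)
        finally show "norm (exp s * x (\<tau> (Suc i)) - exp (\<tau> i) * x s) \<le> \<epsilon>"
          using \<delta>[of "(s, \<tau> (Suc i))" "(\<tau> i, s)"] s le \<tau>(1)[of i]
          by (auto simp: dist_real_def)
      qed
      then show "norm (?R i) \<le> \<epsilon> * (t / n)" by (simp add: \<tau>)
    qed
    also have "\<dots> < r" using n \<open>0 < t\<close> \<open>0 < r\<close> by (simp add: \<epsilon>_def)
    finally show "norm ((\<Sum>i<n. exp (t * i / n) * (c * (\<beta> (t * Suc i / n) - \<beta> (t * i / n))))
      - (exp t * x t - x 0)) < r"
      by (simp add: \<tau>_def norm_minus_commute)
  qed
qed

section \<open>Gaussian law of the process at a fixed time\<close>

lemma (in prob_space) char_distr_normal: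
  assumes "0 < \<sigma>" and X: "distributed M lborel X (normal_density 0 \<sigma>)"
  shows "char (distr M borel X) u = complex_of_real (exp (- (\<sigma> * u)\<^sup>2 / 2))"
proof -
  have [measurable]: "X \<in> borel_measurable M"
    using distributed_measurable[OF X] by simp
  have "distributed M lborel (\<lambda>x. X x / \<sigma>) std_normal_density"
    using X normal_standard_normal_convert[OF \<open>0 < \<sigma>\<close>, of X 0] by simp
  then have "distr M lborel (\<lambda>x. X x / \<sigma>) = std_normal_distribution"
    by (rule distributed_distr_eq_density)
  then have "char (distr M lborel (\<lambda>x. X x / \<sigma>)) (\<sigma> * u) = complex_of_real (exp (- (\<sigma> * u)\<^sup>2 / 2))"
    by (simp add: char_std_normal_distribution)
  moreover have "char (distr M lborel (\<lambda>x. X x / \<sigma>)) (\<sigma> * u) = char (distr M borel X) u"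
    using \<open>0 < \<sigma>\<close> by (simp add: char_def integral_distr)
  ultimately show ?thesis by simp
qed

lemma char_normal_distribution:
  assumes "0 < \<sigma>"
  shows "char (density lborel (normal_density 0 \<sigma>)) u = complex_of_real (exp (- (\<sigma> * u)\<^sup>2 / 2))"
proof -
  let ?N = "density lborel (\<lambda>x. ennreal (normal_density 0 \<sigma> x))"
  interpret prob_space ?N
    using assms by (rule prob_space_normal_density)
  \<comment> \<open>On the real line equipped with the normal law, the identity is a random variable
    with that law, so the preceding lemma applies.\<close>
  have "distr ?N lborel (\<lambda>x. x) = ?N"
    by (simp add: distr_id2)
  then have "distributed ?N lborel (\<lambda>x. x) (normal_density 0 \<sigma>)"
    unfolding distributed_def by simp
  from char_distr_normal[OF assms this] show ?thesis
    by (simp add: distr_id2)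
qed

text \<open>Scaled increments are independent centred Gaussians, so their variances add. Positive
  weights, strictly increasing times and \<open>n > 0\<close> keep all variances positive, so that a
  density exists at every stage.\<close>

lemma weighted_brownian_increments_normal:
  assumes B: "standard_brownian_motion P B" and "strict_mono \<tau>" "0 \<le> \<tau> 0" "n > 0"
    and w: "\<And>i. w i > 0"
  shows "distributed P lborel (\<lambda>\<omega>. \<Sum>i<n. w i * (B (\<tau> (Suc i)) \<omega> - B (\<tau> i) \<omega>))
           (normal_density 0 (sqrt (\<Sum>i<n. (w i)\<^sup>2 * (\<tau> (Suc i) - \<tau> i))))"
proof -
  interpret prob_space P using B by (simp add: standard_brownian_motion_def)
  have nonneg: "0 \<le> \<tau> i" for i
    using assms(3) strict_mono_less_eq[OF assms(2), of 0 i] by simp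
  have less: "\<tau> i < \<tau> (Suc i)" for i
    using strict_monoD[OF assms(2), of i "Suc i"] by simp
  have "indep_vars (\<lambda>_. borel) (\<lambda>i \<omega>. B (\<tau> (Suc i)) \<omega> - B (\<tau> i) \<omega>) {..<n}"
    using B assms(3) strict_mono_mono[OF assms(2)] unfolding standard_brownian_motion_def by blast
  then have "indep_vars (\<lambda>_. borel) (\<lambda>i \<omega>. w i * (B (\<tau> (Suc i)) \<omega> - B (\<tau> i) \<omega>)) {..<n}"
    by (rule indep_vars_compose2) simp
  moreover have "distributed P lborel (\<lambda>\<omega>. w i * (B (\<tau> (Suc i)) \<omega> - B (\<tau> i) \<omega>))
      (normal_density 0 (w i * sqrt (\<tau> (Suc i) - \<tau> i)))" for i
  proof -
    have "distributed P lborel (\<lambda>\<omega>. B (\<tau> (Suc i)) \<omega> - B (\<tau> i) \<omega>)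
        (normal_density 0 (sqrt (\<tau> (Suc i) - \<tau> i)))"
      using B nonneg less unfolding standard_brownian_motion_def by blast
    from normal_density_affine[OF this, of "w i" 0] show ?thesis
      using less[of i] w[of i] by simp
  qed
  ultimately have "distributed P lborel (\<lambda>\<omega>. \<Sum>i<n. w i * (B (\<tau> (Suc i)) \<omega> - B (\<tau> i) \<omega>))
      (normal_density (\<Sum>i<n. 0) (sqrt (\<Sum>i<n. (w i * sqrt (\<tau> (Suc i) - \<tau> i))\<^sup>2)))"
    using \<open>n > 0\<close> w less by (intro sum_indep_normal) (auto simp: intro!: mult_pos_pos)
  moreover have "(w i * sqrt (\<tau> (Suc i) - \<tau> i))\<^sup>2 = (w i)\<^sup>2 * (\<tau> (Suc i) - \<tau> i)" for i
    using less[of i] by (simp add: power_mult_distrib)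
  ultimately show ?thesis by simp
qed

text \<open>These are Riemann sums for the integral of \<open>exp (2 * s)\<close> over
  \<open>{0..t}\<close>. They are also geometric sums of ratio \<open>exp (2 * t / n)\<close>, which
  gives a closed form whose limit is elementary.\<close>

lemma exp_Riemann_sum_limit:
  assumes "0 < t"
  shows "(\<lambda>n. \<Sum>i<n. (exp (t * real i / real n))\<^sup>2 * (t / real n)) \<longlonglongrightarrow> (exp (2 * t) - 1) / 2"
proof -
  have "(\<lambda>n. (exp (2 * t) - 1) / (exp (2 * t / real n) - 1) * (t / real n))
          \<longlonglongrightarrow> (exp (2 * t) - 1) / 2"
  proof -
    have "(\<lambda>n. (t / real n) / (exp (2 * t / real n) - 1)) \<longlonglongrightarrow> 1 / 2"
      using assms by real_asymp
    from tendsto_mult_left[OF this, of "exp (2 * t) - 1"] show ?thesis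
      by (simp add: mult.commute)
  qed
  moreover have "(\<Sum>i<n. (exp (t * real i / real n))\<^sup>2 * (t / real n))
      = (exp (2 * t) - 1) / (exp (2 * t / real n) - 1) * (t / real n)" if "n > 0" for n
  proof -
    have "(exp (t * real i / real n))\<^sup>2 = exp (2 * t / real n) ^ i" for i
      by (simp flip: exp_of_nat_mult exp_double add: field_simps)
    moreover have "exp (2 * t / real n) ^ n = exp (2 * t)"
      using that by (simp flip: exp_of_nat_mult)
    ultimately show ?thesis
      using that assms by (simp add: geometric_sum flip: sum_distrib_right sum_divide_distrib)
  qed
  ultimately show ?thesis
    by (subst tendsto_cong[OF eventually_mono[OF eventually_gt_at_top[of 0]]]) auto
qed

text \<open>Strict positivity of \<open>t\<close> makes the limiting variance positive; at time 0
  the law is a point mass without a density.\<close>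

lemma ornstein_uhlenbeck_normal:
  assumes OU: "ornstein_uhlenbeck P B 0 X" and "0 < t"
  shows "distr P borel (X t) = density lborel (normal_density 0 (sqrt (1 - exp (- 2 * t))))"
proof -
  have B: "standard_brownian_motion P B" using OU by (simp add: ornstein_uhlenbeck_def)
  interpret prob_space P using B by (simp add: standard_brownian_motion_def)
  have [measurable]: "X t \<in> borel_measurable P"
    using OU \<open>0 < t\<close> by (simp add: ornstein_uhlenbeck_def)
  define \<tau> where "\<tau> n i = t * real i / real n" for n i :: nat
  have [measurable]: "B (\<tau> n i) \<in> borel_measurable P" for n i
    using B \<open>0 < t\<close> by (simp add: standard_brownian_motion_def \<tau>_def)
  \<comment> \<open>The factor \<open>sqrt 2\<close> comes from the noise,
    \<open>exp (\<tau> n i)\<close> is the integrating factor at the left endpoint, and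
    \<open>exp (- t)\<close> undoes that factor at time \<open>t\<close>, so that \<open>S n\<close>
    tends to \<open>X t\<close> itself.\<close>
  define w where "w n i = exp (- t) * (exp (\<tau> n i) * sqrt 2)" for n i
  define S where "S n \<omega> = (\<Sum>i<n. w n i * (B (\<tau> n (Suc i)) \<omega> - B (\<tau> n i) \<omega>))" for n \<omega>
  define V where "V n = (\<Sum>i<n. (w n i)\<^sup>2 * (\<tau> n (Suc i) - \<tau> n i))" for n
  have [measurable]: "S n \<in> borel_measurable P" for n
    unfolding S_def by measurable
  have AE_S: "AE \<omega> in P. (\<lambda>n. S n \<omega>) \<longlonglongrightarrow> X t \<omega>"
  proof -
    have "AE \<omega> in P. X 0 \<omega> = 0"
      and "AE \<omega> in P. continuous_on {0..} (\<lambda>t. X t \<omega>)"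
      and "AE \<omega> in P. \<forall>t\<ge>0. X t \<omega> = X 0 \<omega> + integral {0..t} (\<lambda>s. - X s \<omega>) + sqrt 2 * B t \<omega>"
      using OU unfolding ornstein_uhlenbeck_def by blast+
    then show ?thesis
    proof eventually_elim
      case (elim \<omega>)
      have "(\<lambda>n. \<Sum>i<n. exp (t * i / n) * (sqrt 2 * (B (t * Suc i / n) \<omega> - B (t * i / n) \<omega>)))
           \<longlonglongrightarrow> exp t * X t \<omega> - X 0 \<omega>"
      proof (rule additive_noise_path_limit[OF \<open>0 < t\<close>])
        show "continuous_on {0..t} (\<lambda>s. X s \<omega>)"
          by (rule continuous_on_subset[OF elim(2)]) auto
        show "X s \<omega> = X 0 \<omega> + integral {0..s} (\<lambda>s. - X s \<omega>) + sqrt 2 * B s \<omega>"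
          if "s \<in> {0..t}" for s using elim(3) that by (meson atLeastAtMost_iff)
      qed
      from tendsto_mult_left[OF this, of "exp (- t)"]
      have "(\<lambda>n. S n \<omega>) \<longlonglongrightarrow> exp (- t) * (exp t * X t \<omega> - X 0 \<omega>)"
        by (simp add: S_def w_def \<tau>_def sum_distrib_left mult.assoc)
      also have "exp (- t) * (exp t * X t \<omega> - X 0 \<omega>) = X t \<omega>"
        using elim(1) by (simp add: exp_minus field_simps)
      finally show ?case .
    qed
  qed
  \<comment> \<open>All cells have length \<open>t / n\<close>, so the variance \<open>V n\<close>
    is \<open>2 * exp (- 2 * t)\<close> times the Riemann sum above.\<close>
  have "(\<lambda>n. (exp (- t))\<^sup>2 * 2 * (\<Sum>i<n. (exp (t * real i / real n))\<^sup>2 * (t / real n)))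
      \<longlonglongrightarrow> (exp (- t))\<^sup>2 * 2 * ((exp (2 * t) - 1) / 2)"
    by (intro tendsto_intros exp_Riemann_sum_limit \<open>0 < t\<close>)
  also have "(\<lambda>n. (exp (- t))\<^sup>2 * 2 * (\<Sum>i<n. (exp (t * real i / real n))\<^sup>2 * (t / real n))) = V"
    unfolding V_def w_def \<tau>_def sum_distrib_left
    by (intro ext sum.cong) (auto simp: power_mult_distrib field_simps)
  also have "(exp (- t))\<^sup>2 * 2 * ((exp (2 * t) - 1) / 2) = 1 - exp (- 2 * t)"
    by (simp add: right_diff_distrib flip: exp_double exp_add)
  finally have V: "V \<longlonglongrightarrow> 1 - exp (- 2 * t)" .
  \<comment> \<open>For \<open>n = 0\<close> division by zero collapses the grid to 0 and
    \<open>S 0\<close> is an empty sum; the Gaussian law starts at \<open>n = 1\<close>, which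
    suffices for the limit.\<close>
  have char_S: "char (distr P borel (S n)) u = complex_of_real (exp (- (V n * u\<^sup>2) / 2))"
    if "n > 0" for n u
  proof -
    have mono: "strict_mono (\<tau> n)"
      using \<open>0 < t\<close> that by (auto simp: strict_mono_def \<tau>_def field_simps)
    have "distributed P lborel (S n) (normal_density 0 (sqrt (V n)))"
      unfolding S_def V_def
      by (intro weighted_brownian_increments_normal[OF B mono _ that]) (auto simp: \<tau>_def w_def)
    moreover have "V n > 0"
      unfolding V_def using that strict_monoD[OF mono]
      by (intro sum_pos mult_pos_pos) (auto simp: w_def)
    ultimately show ?thesis
      using char_distr_normal[of "sqrt (V n)" "S n" u] by (simp add: power_mult_distrib)
  qed
  define \<sigma> where "\<sigma> = sqrt (1 - exp (- 2 * t))"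
  have "\<sigma> > 0" "\<sigma>\<^sup>2 = 1 - exp (- 2 * t)" using \<open>0 < t\<close> by (auto simp: \<sigma>_def)
  have char_X: "char (distr P borel (X t)) u = complex_of_real (exp (- (\<sigma> * u)\<^sup>2 / 2))" for u
  proof (rule LIMSEQ_unique)
    show "(\<lambda>n. char (distr P borel (S n)) u) \<longlonglongrightarrow> char (distr P borel (X t)) u"
    proof -
      have "(\<lambda>n. \<integral>\<omega>. iexp (u * S n \<omega>) \<partial>P) \<longlonglongrightarrow> (\<integral>\<omega>. iexp (u * X t \<omega>) \<partial>P)"
      \<comment> \<open>The values of \<open>iexp\<close> lie on the unit circle, so the constant 1
        dominates, and it is integrable for a probability measure.\<close>
      proof (rule integral_dominated_convergence[where w = "\<lambda>_. 1"])
        show "AE \<omega> in P. (\<lambda>n. iexp (u * S n \<omega>)) \<longlonglongrightarrow> iexp (u * X t \<omega>)"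
          using AE_S by eventually_elim (intro tendsto_intros)
      qed simp_all
      then show ?thesis by (simp add: char_def integral_distr)
    qed
    have "(\<lambda>n. complex_of_real (exp (- (V n * u\<^sup>2) / 2)))
        \<longlonglongrightarrow> complex_of_real (exp (- ((1 - exp (- 2 * t)) * u\<^sup>2) / 2))"
      by (intro tendsto_intros V) auto
    then show "(\<lambda>n. char (distr P borel (S n)) u)
        \<longlonglongrightarrow> complex_of_real (exp (- (\<sigma> * u)\<^sup>2 / 2))"
      unfolding power_mult_distrib \<open>\<sigma>\<^sup>2 = _\<close>
      by (subst tendsto_cong[OF eventually_mono[OF eventually_gt_at_top[of 0]]])
        (auto simp: char_S)
  qed
  have "real_distribution (density lborel (normal_density 0 \<sigma>))"
    using prob_space_normal_density[OF \<open>\<sigma> > 0\<close>, of 0]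
    by (simp add: real_distribution_def real_distribution_axioms_def)
  then have "distr P borel (X t) = density lborel (normal_density 0 \<sigma>)"
    by (intro Levy_uniqueness ext) (simp_all add: char_X char_normal_distribution \<open>\<sigma> > 0\<close>)
  then show ?thesis by (simp add: \<sigma>_def)
qed

section \<open>Total variation estimates\<close>

lemma tv_dist_leI:
  assumes "\<And>f. f \<in> borel_measurable borel \<Longrightarrow> (\<And>x. \<bar>f x\<bar> \<le> 1) \<Longrightarrow>
    integral\<^sup>L \<nu> f - integral\<^sup>L \<mu> f \<le> 2 * c"
  shows "tv_dist \<nu> \<mu> \<le> c"
proof -
  \<comment> \<open>A real supremum is bounded by an upper bound only over a nonempty set; the zero
    function is a witness.\<close>
  have "(\<lambda>_. 0) \<in> {f \<in> borel_measurable borel. \<forall>x::real. \<bar>f x\<bar> \<le> (1::real)}" by simp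
  then have "(SUP f\<in>{f \<in> borel_measurable borel. \<forall>x. \<bar>f x\<bar> \<le> 1}.
      integral\<^sup>L \<nu> f - integral\<^sup>L \<mu> f) \<le> 2 * c"
    using assms by (intro cSUP_least) blast+
  then show ?thesis by (simp add: tv_dist_def)
qed

text \<open>This serves for small times, where the density comparison degenerates because
  \<open>1 / \<sigma>\<close> blows up.\<close>

lemma tv_dist_le_1:
  assumes "prob_space \<nu>" "prob_space \<mu>"
  shows "tv_dist \<nu> \<mu> \<le> 1"
proof (rule tv_dist_leI)
  fix f :: "real \<Rightarrow> real" assume f: "\<And>x. \<bar>f x\<bar> \<le> 1"
  have "\<bar>integral\<^sup>L \<kappa> f\<bar> \<le> 1" if "prob_space \<kappa>" for \<kappa>
  proof -
    interpret prob_space \<kappa> by fact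
    have "\<bar>integral\<^sup>L \<kappa> f\<bar> \<le> (\<integral>x. \<bar>f x\<bar> \<partial>\<kappa>)"
      by (rule integral_abs_bound)
    also have "\<dots> \<le> (\<integral>x. 1 \<partial>\<kappa>)"
      using f by (intro integral_mono') auto
    finally show ?thesis by (simp add: prob_space)
  qed
  from this[OF assms(1)] this[OF assms(2)]
  show "integral\<^sup>L \<nu> f - integral\<^sup>L \<mu> f \<le> 2 * 1" by linarith
qed

text \<open>Shrinking the variance only lowers the exponential factor, so the loss is the ratio
  \<open>1 / \<sigma>\<close> of the normalising constants, attained at 0.\<close>

lemma normal_density_le_std_normal_density:
  assumes "0 < \<sigma>" "\<sigma> \<le> 1"
  shows "normal_density 0 \<sigma> x \<le> std_normal_density x / \<sigma>"
proof -
  have "x\<^sup>2 * \<sigma>\<^sup>2 \<le> x\<^sup>2 * 1"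
    using assms by (intro mult_left_mono) (auto simp: power_le_one)
  then have "- x\<^sup>2 / (2 * \<sigma>\<^sup>2) \<le> - x\<^sup>2 / 2"
    using assms by (simp add: field_simps)
  then have "exp (- x\<^sup>2 / (2 * \<sigma>\<^sup>2)) / (sqrt (2 * pi) * \<sigma>) \<le> exp (- x\<^sup>2 / 2) / (sqrt (2 * pi) * \<sigma>)"
    using assms by (intro divide_right_mono) auto
  then show ?thesis
    using assms by (simp add: normal_density_def real_sqrt_mult mult.commute)
qed

text \<open>With \<open>k = 1 / \<sigma>\<close>, the difference \<open>\<psi> - \<phi>\<close>
  equals \<open>(k - 1) * \<phi>\<close> minus \<open>k * \<phi> - \<psi>\<close>. Both are
  nonnegative with integral \<open>k - 1\<close>, so a test function bounded by 1 sees at most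
  \<open>2 * (k - 1)\<close>, which the normalisation of \<open>tv_dist\<close> halves.\<close>

lemma tv_dist_normal_std_gaussian:
  assumes "0 < \<sigma>" "\<sigma> \<le> 1"
  shows "tv_dist (density lborel (normal_density 0 \<sigma>)) std_gaussian \<le> 1 / \<sigma> - 1"
proof (rule tv_dist_leI)
  fix f :: "real \<Rightarrow> real"
  assume [measurable]: "f \<in> borel_measurable borel" and f: "\<bar>f x\<bar> \<le> 1" for x
  define \<phi> where "\<phi> = std_normal_density"
  define \<psi> where "\<psi> = normal_density 0 \<sigma>"
  have [measurable]: "\<phi> \<in> borel_measurable borel" "\<psi> \<in> borel_measurable borel"
    by (simp_all add: \<phi>_def \<psi>_def)
  have nonneg: "0 \<le> \<phi> x" "0 \<le> \<psi> x" for x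
    by (simp_all add: \<phi>_def \<psi>_def normal_density_nonneg)
  have int: "integrable lborel \<phi>" "integrable lborel \<psi>" "(\<integral>x. \<phi> x \<partial>lborel) = 1" "(\<integral>x. \<psi> x \<partial>lborel) = 1"
    using assms by (simp_all add: \<phi>_def \<psi>_def)
  have int_f: "integrable lborel (\<lambda>x. h x * f x)"
    if "integrable lborel h" "\<And>x. 0 \<le> h x" for h
    using that f by (intro Bochner_Integration.integrable_bound[OF that(1)] AE_I2)
      (auto simp: abs_mult intro: mult_left_le)
  define k where "k = 1 / \<sigma>"
  \<comment> \<open>The right-hand side is the sum of the two nonnegative parts, using
    \<open>f x \<le> 1\<close> on the first and \<open>- f x \<le> 1\<close> on the second.\<close>
  have pw: "\<psi> x * f x - \<phi> x * f x \<le> (2 * k - 1) * \<phi> x - \<psi> x" for x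
  proof -
    have "(k - 1) * \<phi> x * f x \<le> (k - 1) * \<phi> x * 1"
      using assms nonneg f[of x] by (intro mult_left_mono mult_nonneg_nonneg) (auto simp: k_def)
    moreover have "(k * \<phi> x - \<psi> x) * (- f x) \<le> (k * \<phi> x - \<psi> x) * 1"
      using f[of x] normal_density_le_std_normal_density[OF assms, of x]
      by (intro mult_left_mono) (auto simp: \<phi>_def \<psi>_def k_def)
    ultimately show ?thesis by (simp add: algebra_simps)
  qed
  have "integral\<^sup>L (density lborel \<psi>) f - integral\<^sup>L std_gaussian f
      = (\<integral>x. \<psi> x * f x \<partial>lborel) - (\<integral>x. \<phi> x * f x \<partial>lborel)"
    using nonneg by (simp add: std_gaussian_def \<phi>_def[symmetric] integral_density)
  also have "\<dots> = (\<integral>x. \<psi> x * f x - \<phi> x * f x \<partial>lborel)"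
    by (intro Bochner_Integration.integral_diff[symmetric] int_f int nonneg)
  also have "\<dots> \<le> (\<integral>x. (2 * k - 1) * \<phi> x - \<psi> x \<partial>lborel)"
    using pw by (intro integral_mono Bochner_Integration.integrable_diff int_f int nonneg
        integrable_mult_right)
  also have "\<dots> = 2 * (1 / \<sigma> - 1)"
    using int by (simp add: Bochner_Integration.integral_diff k_def)
  finally show "integral\<^sup>L (density lborel (normal_density 0 \<sigma>)) f - integral\<^sup>L std_gaussian f
      \<le> 2 * (1 / \<sigma> - 1)" by (simp add: \<psi>_def)
qed

text \<open>While \<open>exp (- 2 * t)\<close> is at least 1/2, the trivial bound 1 suffices.
  Afterwards \<open>\<sigma>\<close> stays away from 0, and \<open>1 / \<sigma> - 1\<close> is
  comparable to \<open>1 - \<sigma>\<^sup>2 = exp (- 2 * t)\<close>.\<close>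

lemma ornstein_uhlenbeck_tv_dist:
  assumes OU: "ornstein_uhlenbeck P B 0 X" and "0 \<le> t"
  shows "tv_dist (distr P borel (X t)) std_gaussian \<le> 2 * exp (- 2 * t)"
proof (cases "exp (- 2 * t) \<ge> 1 / 2")
  case True
  interpret prob_space P
    using OU by (simp add: ornstein_uhlenbeck_def standard_brownian_motion_def)
  have "prob_space std_gaussian"
    unfolding std_gaussian_def by (intro prob_space_normal_density) simp
  moreover have "prob_space (distr P borel (X t))"
    using OU \<open>0 \<le> t\<close> by (intro prob_space_distr) (simp add: ornstein_uhlenbeck_def)
  ultimately show ?thesis
    using tv_dist_le_1[of "distr P borel (X t)" std_gaussian] True by linarith
next
  case False
  then have "t > 0" using \<open>0 \<le> t\<close> by (cases "t = 0") auto
  define \<sigma> where "\<sigma> = sqrt (1 - exp (- 2 * t))"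
  have sq: "\<sigma>\<^sup>2 = 1 - exp (- 2 * t)" and "0 < \<sigma>" "\<sigma> \<le> 1"
    using \<open>t > 0\<close> by (auto simp: \<sigma>_def)
  have "1 / 2 \<le> \<sigma>"
    unfolding \<sigma>_def by (rule real_le_rsqrt) (use False in \<open>simp add: power2_eq_square\<close>)
  \<comment> \<open>Since \<open>1 / \<sigma> - 1 = (1 - \<sigma>\<^sup>2) / (\<sigma> * (1 +
    \<sigma>))\<close>, the constant 2 works as soon as \<open>2 * \<sigma> * (1 + \<sigma>)\<close>
    is at least 1.\<close>
  then have "1 * 1 \<le> (2 * \<sigma>) * (1 + \<sigma>)"
    by (intro mult_mono) auto
  then have "(1 - \<sigma>) * 1 \<le> (1 - \<sigma>) * (2 * \<sigma> * (1 + \<sigma>))"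
    using \<open>\<sigma> \<le> 1\<close> by (intro mult_left_mono) auto
  then have "1 / \<sigma> - 1 \<le> 2 * (1 - \<sigma>\<^sup>2)"
    using \<open>0 < \<sigma>\<close> by (simp add: field_simps power2_eq_square)
  then show ?thesis
    using tv_dist_normal_std_gaussian[OF \<open>0 < \<sigma>\<close> \<open>\<sigma> \<le> 1\<close>] ornstein_uhlenbeck_normal[OF OU \<open>t > 0\<close>]
    unfolding \<sigma>_def[symmetric] sq by simp
qed

theorem mainTheorem4:
  "\<exists>C>0. \<forall>(P :: 'a measure) (B :: real \<Rightarrow> 'a \<Rightarrow> real) (X :: real \<Rightarrow> 'a \<Rightarrow> real).
     ornstein_uhlenbeck P B 0 X \<longrightarrow>
     (\<forall>t\<ge>0. \<forall>M>0.
        tv_dist (distr P borel (X t)) std_gaussian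
          \<le> C * (max 1 M)\<^sup>2 * exp (- 2 * t) + sqrt 2 / (sqrt pi * M) * exp (- M\<^sup>2 / 2))"
proof (intro exI[of _ 2] conjI allI impI)
  fix P :: "'a measure" and B X :: "real \<Rightarrow> 'a \<Rightarrow> real" and t M :: real
  assume "ornstein_uhlenbeck P B 0 X" "t \<ge> 0" "M > 0"
  \<comment> \<open>The factor 1 and the summand 0 are inserted to match the target term by term: 1
    is at most \<open>(max 1 M)\<^sup>2\<close>, and the Gaussian tail term is nonnegative.\<close>
  then have "tv_dist (distr P borel (X t)) std_gaussian \<le> 2 * 1 * exp (- 2 * t) + 0"
    using ornstein_uhlenbeck_tv_dist by fastforce
  also have "\<dots> \<le> 2 * (max 1 M)\<^sup>2 * exp (- 2 * t) + sqrt 2 / (sqrt pi * M) * exp (- M\<^sup>2 / 2)"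
    using \<open>M > 0\<close> by (intro add_mono mult_right_mono mult_left_mono) (auto intro: one_le_power)
  finally show "tv_dist (distr P borel (X t)) std_gaussian
      \<le> 2 * (max 1 M)\<^sup>2 * exp (- 2 * t) + sqrt 2 / (sqrt pi * M) * exp (- M\<^sup>2 / 2)" .
qed simp

end
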